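(* Let $N_t$ be the Galton–Watson process in the i.i.d. random environment $(p_t,\alpha_t)_{t\ge1}$ with generalized geometric offspring laws. Assume that for some small enough $\delta>0$, $$\sum_{t}\mathcal{P}\left(\beta_t<\exp(-(\gamma-\delta)t)\right)<\infty\quad\text{and}\quad \gamma=\mathcal{E}\ln\frac{\beta}{p}>0 .$$ Then the process $N_t\to\infty$ exponentially fast with uniformly positive probability $P(N_t\ge 1)\ge\delta_1$ for some $\delta_1>0$.
   Context: Environment: $(p_t,\alpha_t)$, $t\ge1$, are i.i.d. random vectors with values in $(0,1)^2$; $\beta_t=1-\alpha_t$; $(p,\beta)$ denotes a generic copy of $(p_t,\beta_t)$. $\mathcal{E},\mathcal{P}$ denote total (annealed) expectation and probability, i.e. including averaging over the environment. $P$ denotes the quenched probability, i.e. the conditional probability for a fixed realization of the environment. It is assumed that $\mathcal{E}\ln\frac{\beta}{p}$ is finite. For a fixed environment, $N_0=1$ and $N_t=\sum_{i=1}^{N_{t-1}}\xi_{t,i}$, where the $\xi_{t,i}$ are independent with $P(\xi_{t,i}=0)=\alpha_t$ and $P(\xi_{t,i}=k)=(1-\alpha_t)p_t(1-p_t)^{k-1}$ for $k\ge1$. *)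

theory Defs
  imports "HOL-Probability.Probability"
begin

definition gen_geom :: "real \<Rightarrow> real \<Rightarrow> nat \<Rightarrow> real" where
  "gen_geom p \<alpha> k = (if k = 0 then \<alpha> else (1 - \<alpha>) * p * (1 - p) ^ (k - 1))"

text \<open>Environments, offspring variables and generations are indexed from 1; the values of
  \<open>p\<close>, \<open>\<alpha>\<close> and \<open>\<xi>\<close> at index 0 are junk and never used.\<close>

definition iid_environment ::
  "'a measure \<Rightarrow> (nat \<Rightarrow> 'a \<Rightarrow> real) \<Rightarrow> (nat \<Rightarrow> 'a \<Rightarrow> real) \<Rightarrow> bool" where
  "iid_environment M p \<alpha> \<longleftrightarrow>
     prob_space M \<and>
     (\<forall>t\<ge>1. \<forall>\<omega>\<in>space M. p t \<omega> \<in> {0<..<1} \<and> \<alpha> t \<omega> \<in> {0<..<1}) \<and>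
     prob_space.indep_vars M (\<lambda>_. borel) (\<lambda>t \<omega>. (p t \<omega>, \<alpha> t \<omega>)) {1..} \<and>
     (\<forall>t\<ge>1. distr M borel (\<lambda>\<omega>. (p t \<omega>, \<alpha> t \<omega>)) = distr M borel (\<lambda>\<omega>. (p 1 \<omega>, \<alpha> 1 \<omega>)))"

text \<open>Here \<open>p\<close> and \<open>\<alpha>\<close> are a fixed realization of the environment, and \<open>Q\<close> plays the role
  of the quenched probability for that realization.\<close>

definition quenched_offspring ::
  "(nat \<Rightarrow> real) \<Rightarrow> (nat \<Rightarrow> real) \<Rightarrow> 'b measure \<Rightarrow> (nat \<Rightarrow> nat \<Rightarrow> 'b \<Rightarrow> nat) \<Rightarrow> bool" where
  "quenched_offspring p \<alpha> Q \<xi> \<longleftrightarrow>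
     prob_space Q \<and>
     prob_space.indep_vars Q (\<lambda>_. count_space UNIV) (\<lambda>(t, i). \<xi> t i) ({1..} \<times> {1..}) \<and>
     (\<forall>t\<ge>1. \<forall>i\<ge>1. \<forall>k. measure Q {x \<in> space Q. \<xi> t i x = k} = gen_geom (p t) (\<alpha> t) k)"

primrec gw_process :: "(nat \<Rightarrow> nat \<Rightarrow> 'b \<Rightarrow> nat) \<Rightarrow> nat \<Rightarrow> 'b \<Rightarrow> nat" where
  "gw_process \<xi> 0 x = 1"
| "gw_process \<xi> (Suc t) x = (\<Sum>i = 1..gw_process \<xi> t x. \<xi> (Suc t) i x)"

end

(* Put B_t = prod_{i <= t} p_i / beta_i and A_t = sum_{i <= t} B_{i-1} (1 - p_i) / beta_i. The
   generating functions of the offspring laws are fractional linear and fix 1, so that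
   1 / (1 - E s^{N_t}) = A_t + B_t / (1 - s) for the quenched expectation. Hence
   P(N_t >= 1) = 1 / (A_t + B_t), and P(1 <= N_t <= y) <= e B_t y by Markov's inequality applied
   to s^{N_t} with s = exp (-1 / y).

   For every r < gamma, B_t <= exp (C - r t) almost surely for some random C: this says that a
   random walk with i.i.d. steps of negative mean is bounded above, which follows from the
   recursion for the running maximum and Kolmogorov's 0-1 law. By the hypothesis on beta_t and
   Borel-Cantelli, 1 / beta_t <= exp ((gamma - delta) t) eventually, so A_t converges as soon
   as r > gamma - delta, and the survival probability is positive. Finally
   P(1 <= N_t <= exp (r t / 2)) <= exp (1 + C - r t / 2) is summable, and Borel-Cantelli
   gives exponential growth on survival. *)

theory Submission
  imports Defs
begin

section \<open>Running maxima of partial sums\<close>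

text \<open>This is the maximum over \<open>m \<le> n\<close> of the sums of
  \<open>y k, ..., y (k + m - 1)\<close>, the empty sum included. The recursion peels off the first
  term, so that in the random case \<open>y k\<close> is independent of the remaining
  maximum.\<close>

primrec maxsum :: "(nat \<Rightarrow> real) \<Rightarrow> nat \<Rightarrow> nat \<Rightarrow> real" where
  "maxsum y 0 k = 0"
| "maxsum y (Suc n) k = max 0 (y k + maxsum y n (Suc k))"

lemma maxsum_nonneg: "0 \<le> maxsum y n k"
  by (cases n) auto

lemma maxsum_le_Suc: "maxsum y n k \<le> maxsum y (Suc n) k"
proof (induction n arbitrary: k)
  case (Suc n)
  have "y k + maxsum y n (Suc k) \<le> y k + maxsum y (Suc n) (Suc k)"
    using Suc[of "Suc k"] by simp
  then show ?case
    unfolding maxsum.simps(2)[of y n k] maxsum.simps(2)[of y "Suc n" k] by linarith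
qed simp

lemma maxsum_mono: "m \<le> n \<Longrightarrow> maxsum y m k \<le> maxsum y n k"
  by (rule lift_Suc_mono_le[of "\<lambda>n. maxsum y n k"]) (rule maxsum_le_Suc)

lemma sum_le_maxsum: "(\<Sum>i<n. y (k + i)) \<le> maxsum y n k"
proof (induction n arbitrary: k)
  case (Suc n)
  show ?case
    using Suc[of "Suc k"] by (simp add: sum.lessThan_Suc_shift del: sum.lessThan_Suc)
qed simp

text \<open>Dropping the first term moves the maxima by a bounded amount only, and shifts
  \<open>n\<close> by one.\<close>

lemma maxsum_unbounded_Suc:
  "(\<forall>K::nat. \<exists>n. maxsum y n (Suc k) > real K) \<longleftrightarrow> (\<forall>K::nat. \<exists>n. maxsum y n k > real K)"
    (is "?L \<longleftrightarrow> ?R")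
proof
  assume L: ?L
  show ?R
  proof
    fix K :: nat
    obtain K' :: nat where K': "real K - y k \<le> real K'"
      using real_arch_simple by blast
    obtain n where "maxsum y n (Suc k) > real K'"
      using L by blast
    then have "maxsum y (Suc n) k > real K"
      using K' by simp
    then show "\<exists>n. maxsum y n k > real K" ..
  qed
next
  assume R: ?R
  show ?L
  proof
    fix K :: nat
    obtain K' :: nat where K': "real K + \<bar>y k\<bar> \<le> real K'"
      using real_arch_simple by blast
    obtain n where n: "maxsum y n k > real K'"
      using R by blast
    then obtain m where "n = Suc m"
      by (cases n) auto
    then have "maxsum y m (Suc k) > real K"
      using n K' by (auto simp: less_max_iff_disj)
    then show "\<exists>n. maxsum y n (Suc k) > real K" ..
  qed
qed

text \<open>Makes unboundedness insensitive to any finite number of initial terms, hence a tail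
  event for random \<open>y\<close>.\<close>

lemma maxsum_unbounded_shift:
  "(\<forall>K::nat. \<exists>n. maxsum y n k > real K) \<longleftrightarrow> (\<forall>K::nat. \<exists>n. maxsum y n 0 > real K)"
  by (induction k) (simp_all only: maxsum_unbounded_Suc)

lemma maxsum_cong: "(\<And>i. k \<le> i \<Longrightarrow> y i = z i) \<Longrightarrow> maxsum y n k = maxsum z n k"
  by (induction n arbitrary: k) simp_all

lemma measurable_maxsum:
  assumes "\<And>i. k \<le> i \<Longrightarrow> (\<lambda>\<omega>. Y \<omega> i) \<in> borel_measurable N"
  shows "(\<lambda>\<omega>. maxsum (Y \<omega>) n k) \<in> borel_measurable N"
  using assms
proof (induction n arbitrary: k)
  case (Suc n)
  have "(\<lambda>\<omega>. Y \<omega> k) \<in> borel_measurable N"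
    using Suc.prems by simp
  moreover have "(\<lambda>\<omega>. maxsum (Y \<omega>) n (Suc k)) \<in> borel_measurable N"
    using Suc.prems by (intro Suc.IH) simp
  ultimately show ?case by simp
qed simp

section \<open>Random walks with i.i.d. steps\<close>

locale iid_sequence = prob_space M for M :: "'a measure" +
  fixes Y :: "nat \<Rightarrow> 'a \<Rightarrow> real"
  assumes indep: "indep_vars (\<lambda>_. borel) Y UNIV"
    and distr_eq: "\<And>i. distr M borel (Y i) = distr M borel (Y 0)"
    and int0: "integrable M (Y 0)"
begin

lemma meas [measurable]: "Y i \<in> borel_measurable M"
  using indep unfolding indep_vars_def by blast

lemma integrable_Y: "integrable M (Y i)"
proof -
  have "integrable (distr M borel (Y i)) (\<lambda>x. x)"
    using int0 unfolding distr_eq[of i] by (subst integrable_distr_eq) simp_all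
  then show ?thesis
    by (subst (asm) integrable_distr_eq) simp_all
qed

abbreviation "W n k \<equiv> (\<lambda>\<omega>. maxsum (\<lambda>i. Y i \<omega>) n k)"

lemma measurable_W [measurable]: "W n k \<in> borel_measurable M"
  by (rule measurable_maxsum) simp

text \<open>\<open>W n (Suc k)\<close> reads only the variables \<open>Y i\<close> with
  \<open>i > k\<close>, so the two sides are functions of disjoint blocks of an independent
  family.\<close>

lemma indep_W: "indep_var borel (Y k) borel (W n (Suc k))"
proof -
  have "indep_var (PiM {k} (\<lambda>_. borel)) (\<lambda>\<omega>. restrict (\<lambda>i. Y i \<omega>) {k})
        (PiM {Suc k..} (\<lambda>_. borel)) (\<lambda>\<omega>. restrict (\<lambda>i. Y i \<omega>) {Suc k..})"
    by (rule indep_var_restrict[OF indep]) auto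
  then have "indep_var borel ((\<lambda>f. f k) \<circ> (\<lambda>\<omega>. restrict (\<lambda>i. Y i \<omega>) {k}))
        borel ((\<lambda>f. maxsum f n (Suc k)) \<circ> (\<lambda>\<omega>. restrict (\<lambda>i. Y i \<omega>) {Suc k..}))"
    by (rule indep_var_compose)
      (auto intro!: measurable_maxsum measurable_component_singleton)
  also have "(\<lambda>f. f k) \<circ> (\<lambda>\<omega>. restrict (\<lambda>i. Y i \<omega>) {k}) = Y k"
    by auto
  also have "(\<lambda>f. maxsum f n (Suc k)) \<circ> (\<lambda>\<omega>. restrict (\<lambda>i. Y i \<omega>) {Suc k..}) = W n (Suc k)"
    by (auto simp: fun_eq_iff intro!: maxsum_cong)
  finally show ?thesis .
qed

text \<open>\<open>W (Suc n) k\<close> is a fixed function of the independent pair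
  \<open>Y k\<close>, \<open>W n (Suc k)\<close>, and by induction neither marginal law depends on
  the starting index.\<close>

lemma distr_W: "distr M borel (W n k) = distr M borel (W n 0)"
proof (induction n arbitrary: k)
  case (Suc n)
  have eq: "distr M borel (W (Suc n) k) =
      distr (distr M borel (Y 0) \<Otimes>\<^sub>M distr M borel (W n 0)) borel (\<lambda>(a, b). max 0 (a + b))" for k
  proof -
    have "distr M borel (W (Suc n) k) =
        distr (distr M (borel \<Otimes>\<^sub>M borel) (\<lambda>\<omega>. (Y k \<omega>, W n (Suc k) \<omega>))) borel
          (\<lambda>(a, b). max 0 (a + b))"
      by (subst distr_distr) (auto simp: comp_def)
    also have "distr M (borel \<Otimes>\<^sub>M borel) (\<lambda>\<omega>. (Y k \<omega>, W n (Suc k) \<omega>)) =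
        distr M borel (Y k) \<Otimes>\<^sub>M distr M borel (W n (Suc k))"
      using indep_W[of k n] unfolding indep_var_distribution_eq by simp
    also have "\<dots> = distr M borel (Y 0) \<Otimes>\<^sub>M distr M borel (W n 0)"
      using Suc[of "Suc k"] distr_eq[of k] by simp
    finally show ?thesis .
  qed
  show ?case
    unfolding eq[of k] eq[of 0] ..
qed simp

lemma integrable_W: "integrable M (W n k)"
proof (induction n arbitrary: k)
  case (Suc n)
  show ?case
    using Suc[of "Suc k"] integrable_Y[of k] by simp
qed simp

lemma expectation_W: "expectation (W n k) = expectation (W n 0)"
proof -
  have "expectation (W n j) = (\<integral>x. x \<partial>distr M borel (W n j))" for j
    by (subst integral_distr) simp_all
  then show ?thesis
    using distr_W[of n k] by simp
qed

text \<open>Kolmogorov's 0-1 law: for every \<open>k\<close> the event can be rewritten with maxima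
  started at \<open>k\<close>, which involve only \<open>Y i\<close> with
  \<open>i \<ge> k\<close>.\<close>

lemma prob_unbounded_0_1:
  fixes A :: "'a set"
  defines "A \<equiv> {\<omega> \<in> space M. \<forall>K::nat. \<exists>n. W n 0 \<omega> > real K}"
  shows "prob A = 0 \<or> prob A = 1"
proof (rule kolmogorov_0_1_law[of "\<lambda>i. sigma_sets (space M) {Y i -` B \<inter> space M |B. B \<in> sets borel}"])
  show "sigma_algebra (space M) (sigma_sets (space M) {Y i -` B \<inter> space M |B. B \<in> sets borel})" for i
    by (rule sigma_algebra_sigma_sets) auto
  show "indep_sets (\<lambda>i. sigma_sets (space M) {Y i -` B \<inter> space M |B. B \<in> sets borel}) UNIV"
    using indep unfolding indep_vars_def by blast
  let ?S = "\<lambda>i. sigma_sets (space M) {Y i -` B \<inter> space M |B. B \<in> sets borel}"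
  show "A \<in> tail_events ?S"
    unfolding tail_events_def
  proof
    fix k
    \<comment> \<open>Packaging the \<open>k\<close>-th tail sigma-algebra as a measure lets
      membership of the event be shown by measurability on \<open>N\<close>.\<close>
    define N where "N = sigma (space M) (\<Union> (?S ` {k..}))"
    have sub: "\<Union> (?S ` {k..}) \<subseteq> Pow (space M)"
      by (auto dest!: sigma_sets_into_sp[rotated])
    have sp: "space N = space M" and se: "sets N = sigma_sets (space M) (\<Union> (?S ` {k..}))"
      unfolding N_def using sub by (auto simp: space_measure_of sets_measure_of)
    have Y: "Y i \<in> borel_measurable N" if "k \<le> i" for i
    proof (rule measurableI)
      fix B :: "real set" assume "B \<in> sets borel"
      then have "Y i -` B \<inter> space M \<in> \<Union> (?S ` {k..})"
        using that by (intro UN_I[of i] sigma_sets.Basic) auto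
      then show "Y i -` B \<inter> space N \<in> sets N"
        unfolding sp se by (rule sigma_sets.Basic)
    qed simp
    have W: "W n k \<in> borel_measurable N" for n
      by (rule measurable_maxsum) (rule Y)
    have "A = {\<omega> \<in> space N. \<forall>K::nat. \<exists>n. W n k \<omega> > real K}"
      unfolding A_def sp using maxsum_unbounded_shift by blast
    also have "\<dots> \<in> sets N"
      using W by measurable
    finally show "A \<in> sigma_sets (space M) (\<Union> (?S ` {k..}))"
      unfolding se .
  qed
qed

text \<open>The increment \<open>W (n + 1) 0 - W n 1 = max (- W n 1) (Y 0)\<close> has nonnegative expectation,
  because \<open>W n 1\<close> has the law of \<open>W n 0 \<le> W (n + 1) 0\<close>. If \<open>W\<close> is unbounded, the increment
  converges to \<open>Y 0\<close>, and it is dominated by \<open>\<bar>Y 0\<bar>\<close>.\<close>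

lemma expectation_nonneg_if_unbounded:
  assumes "AE \<omega> in M. \<forall>K::nat. \<exists>n. W n 0 \<omega> > real K"
  shows "0 \<le> expectation (Y 0)"
proof -
  have "(\<lambda>n. expectation (\<lambda>\<omega>. max (- W n 1 \<omega>) (Y 0 \<omega>))) \<longlonglongrightarrow> expectation (Y 0)"
  proof (rule integral_dominated_convergence)
    show "integrable M (\<lambda>\<omega>. \<bar>Y 0 \<omega>\<bar>)"
      using int0 by simp
    show "AE \<omega> in M. (\<lambda>n. max (- W n 1 \<omega>) (Y 0 \<omega>)) \<longlonglongrightarrow> Y 0 \<omega>"
      using assms
    proof eventually_elim
      case (elim \<omega>)
      have unb: "\<forall>K::nat. \<exists>n. W n 1 \<omega> > real K"
        using elim maxsum_unbounded_shift[of "\<lambda>i. Y i \<omega>" 1] by blast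
      obtain K :: nat where K: "- Y 0 \<omega> \<le> real K"
        using real_arch_simple by blast
      obtain n where n: "W n 1 \<omega> > real K"
        using unb by blast
      have "max (- W m 1 \<omega>) (Y 0 \<omega>) = Y 0 \<omega>" if "m \<ge> n" for m
        using maxsum_mono[OF that, of "\<lambda>i. Y i \<omega>" 1] n K by simp
      then show ?case
        by (intro tendsto_eventually eventually_sequentiallyI[of n])
    qed
    show "AE \<omega> in M. norm (max (- W n 1 \<omega>) (Y 0 \<omega>)) \<le> \<bar>Y 0 \<omega>\<bar>" for n
    proof (rule AE_I2)
      fix \<omega>
      \<comment> \<open>If \<open>Y 0\<close> is the smaller entry, then it lies below
        \<open>- W n 1 \<le> 0\<close>, so the maximum is no larger in absolute value.\<close>
      show "norm (max (- W n 1 \<omega>) (Y 0 \<omega>)) \<le> \<bar>Y 0 \<omega>\<bar>"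
        using maxsum_nonneg[of "\<lambda>i. Y i \<omega>" n 1] unfolding real_norm_def by arith
    qed
  qed simp_all
  moreover have "0 \<le> expectation (\<lambda>\<omega>. max (- W n 1 \<omega>) (Y 0 \<omega>))" for n
  proof -
    have "expectation (\<lambda>\<omega>. max (- W n 1 \<omega>) (Y 0 \<omega>)) = expectation (\<lambda>\<omega>. W (Suc n) 0 \<omega> - W n 1 \<omega>)"
      by (rule arg_cong[where f = expectation]) (auto simp: fun_eq_iff)
    also have "\<dots> = expectation (W (Suc n) 0) - expectation (W n 0)"
      using Bochner_Integration.integral_diff[OF integrable_W[of "Suc n" 0] integrable_W[of n 1]]
        expectation_W[of n 1] by simp
    also have "\<dots> \<ge> 0"
      using integral_mono[OF integrable_W[of n 0] integrable_W[of "Suc n" 0] maxsum_le_Suc] by simp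
    finally show ?thesis .
  qed
  ultimately show ?thesis
    by (intro LIMSEQ_le_const) auto
qed

text \<open>A negative mean excludes that the maxima are unbounded almost surely; the 0-1 law then
  leaves only probability 0.\<close>

theorem AE_partial_sums_bounded:
  assumes "expectation (Y 0) < 0"
  shows "AE \<omega> in M. \<exists>C. \<forall>n. (\<Sum>i<n. Y i \<omega>) \<le> C"
proof -
  let ?A = "{\<omega> \<in> space M. \<forall>K::nat. \<exists>n. W n 0 \<omega> > real K}"
  have A: "?A \<in> events"
    by measurable
  have "prob ?A \<noteq> 1"
    using expectation_nonneg_if_unbounded assms prob_Collect_eq_1[OF A] by auto
  then have "prob ?A = 0"
    using prob_unbounded_0_1 by blast
  then have "AE \<omega> in M. \<not> (\<forall>K::nat. \<exists>n. W n 0 \<omega> > real K)"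
    using prob_Collect_eq_0[OF A] by blast
  then show ?thesis
  proof eventually_elim
    case (elim \<omega>)
    then obtain K :: nat where K: "\<And>n. W n 0 \<omega> \<le> real K"
      by (auto simp: not_less)
    have "(\<Sum>i<n. Y i \<omega>) \<le> real K" for n
      using sum_le_maxsum[of "\<lambda>i. Y i \<omega>" 0 n] K[of n] by simp
    then show ?case by blast
  qed
qed

end

section \<open>Generating functions of the generalized geometric laws\<close>

lemma gen_geom_pgf_sums:
  assumes "0 < p" "p < 1" "0 \<le> s" "s < 1"
  shows "(\<lambda>k. gen_geom p \<alpha> k * s ^ k) sums (\<alpha> + (1 - \<alpha>) * p * s / (1 - (1 - p) * s))"
proof -
  have "(1 - p) * s < 1"
    using assms mult_strict_mono[of "1 - p" 1 s 1] by simp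
  then have "(\<lambda>k. ((1 - p) * s) ^ k) sums (1 / (1 - (1 - p) * s))"
    using assms by (intro geometric_sums) simp
  then have "(\<lambda>k. (1 - \<alpha>) * p * s * ((1 - p) * s) ^ k) sums
      ((1 - \<alpha>) * p * s * (1 / (1 - (1 - p) * s)))"
    by (rule sums_mult)
  then have "(\<lambda>k. gen_geom p \<alpha> (Suc k) * s ^ Suc k) sums
      ((1 - \<alpha>) * p * s / (1 - (1 - p) * s))"
    by (simp add: gen_geom_def power_mult_distrib mult_ac)
  \<comment> \<open>Only now does the atom at 0 enter; the terms from index 1 on are geometric with
    ratio \<open>(1 - p) * s\<close>.\<close>
  then show ?thesis
    by (subst (asm) sums_Suc_iff) (simp add: gen_geom_def add.commute)
qed

text \<open>The generating function is fractional linear and fixes 1, so passing to the reciprocal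
  of the complement makes it affine in \<open>1 / (1 - s)\<close>. Iterating over generations then
  only composes affine maps.\<close>

lemma gen_geom_pgf_complement:
  fixes p \<alpha> s :: real
  assumes "0 < p" "p < 1" "\<alpha> < 1" "0 \<le> s" "s < 1"
  shows "1 - (\<alpha> + (1 - \<alpha>) * p * s / (1 - (1 - p) * s)) =
    1 / ((1 - p) / (1 - \<alpha>) + p / (1 - \<alpha>) / (1 - s))"
proof -
  have "(1 - p) * s < 1"
    using assms mult_strict_mono[of "1 - p" 1 s 1] by simp
  then have pos: "1 - (1 - p) * s > 0" by simp
  have lhs: "1 - (\<alpha> + (1 - \<alpha>) * p * s / (1 - (1 - p) * s)) =
      (1 - \<alpha>) * (1 - s) / (1 - (1 - p) * s)"
    using pos by (simp add: field_simps)
  have "(1 - p) / (1 - \<alpha>) + p / (1 - \<alpha>) / (1 - s) =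
      ((1 - p) * (1 - s) + p) / ((1 - \<alpha>) * (1 - s))"
    using assms by (simp add: add_divide_distrib)
  also have "(1 - p) * (1 - s) + p = 1 - (1 - p) * s"
    by (simp add: algebra_simps)
  finally show ?thesis unfolding lhs by simp
qed

section \<open>Expectations split along the values of a discrete variable\<close>

text \<open>Serves as conditioning on the value of \<open>X\<close>. At each point a single term of
  the series is nonzero, and boundedness of \<open>F\<close> justifies exchanging sum and
  integral.\<close>

lemma (in prob_space) expectation_level_sums:
  fixes X :: "'a \<Rightarrow> nat" and F :: "'a \<Rightarrow> real"
  assumes X [measurable]: "X \<in> measurable M (count_space UNIV)"
    and F [measurable]: "F \<in> borel_measurable M"
    and bound: "\<And>x. x \<in> space M \<Longrightarrow> \<bar>F x\<bar> \<le> 1"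
  shows "(\<lambda>k. expectation (\<lambda>x. of_bool (X x = k) * F x)) sums expectation F"
proof -
  let ?f = "\<lambda>k x. of_bool (X x = k) * F x"
  have sums: "(\<lambda>k. ?f k x) sums F x" for x
  proof -
    have "(\<lambda>k. ?f k x) = (\<lambda>k. if k \<in> {X x} then F x else 0)"
      by auto
    then show ?thesis
      using sums_If_finite_set[of "{X x}" "\<lambda>_. F x"] by simp
  qed
  have norms: "(\<lambda>k. norm (?f k x)) sums \<bar>F x\<bar>" for x
  proof -
    have "(\<lambda>k. norm (?f k x)) = (\<lambda>k. if k \<in> {X x} then \<bar>F x\<bar> else 0)"
      by auto
    then show ?thesis
      using sums_If_finite_set[of "{X x}" "\<lambda>_. \<bar>F x\<bar>"] by simp
  qed
  have int: "integrable M (?f k)" for k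
    using bound by (intro integrable_const_bound[of _ 1] AE_I2) (auto simp: abs_mult)
  \<comment> \<open>The level sets are disjoint, so any finite number of them contributes at most
    \<open>\<bar>F x\<bar> \<le> 1\<close> at each point.\<close>
  have partial: "(\<Sum>k<n. expectation (\<lambda>x. norm (?f k x))) \<le> 1" for n
  proof -
    have "(\<Sum>k<n. expectation (\<lambda>x. norm (?f k x))) = expectation (\<lambda>x. \<Sum>k<n. norm (?f k x))"
      by (rule Bochner_Integration.integral_sum[symmetric]) (intro integrable_norm int)
    also have "\<dots> \<le> expectation (\<lambda>x. 1)"
    proof (rule integral_mono)
      show "integrable M (\<lambda>x. \<Sum>k<n. norm (?f k x))"
        by (intro Bochner_Integration.integrable_sum integrable_norm int)
      fix x assume "x \<in> space M"
      then show "(\<Sum>k<n. norm (?f k x)) \<le> 1"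
        using sum_le_suminf[OF sums_summable[OF norms[of x]], of "{..<n}"]
          sums_unique[OF norms[of x]] bound[of x] by simp
    qed simp
    finally show ?thesis by (simp add: prob_space)
  qed
  have "(\<lambda>k. expectation (?f k)) sums expectation (\<lambda>x. \<Sum>k. ?f k x)"
  proof (rule sums_integral)
    show "AE x in M. summable (\<lambda>k. norm (?f k x))"
      using norms by (auto intro!: AE_I2 dest: sums_summable)
    show "summable (\<lambda>k. expectation (\<lambda>x. norm (?f k x)))"
      using partial by (intro summableI_nonneg_bounded[of _ 1]) simp_all
  qed (rule int)
  also have "(\<lambda>x. \<Sum>k. ?f k x) = F"
    using sums_unique[OF sums] by (simp add: fun_eq_iff)
  finally show ?thesis .
qed

lemma (in prob_space) expectation_of_bool:
  assumes [measurable]: "Measurable.pred M P"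
  shows "expectation (\<lambda>x. of_bool (P x) :: real) = prob {x \<in> space M. P x}"
proof -
  have "expectation (\<lambda>x. of_bool (P x) :: real) = expectation (indicator {x \<in> space M. P x})"
    by (rule Bochner_Integration.integral_cong) (auto simp: indicator_def)
  then show ?thesis by simp
qed

lemma (in prob_space) expectation_nat_sums:
  fixes X :: "'a \<Rightarrow> nat" and g :: "nat \<Rightarrow> real"
  assumes X [measurable]: "X \<in> measurable M (count_space UNIV)"
    and g: "\<And>k. \<bar>g k\<bar> \<le> 1"
  shows "(\<lambda>k. prob {x \<in> space M. X x = k} * g k) sums expectation (\<lambda>x. g (X x))"
proof -
  have "(\<lambda>x. of_bool (X x = k) * g (X x)) = (\<lambda>x. of_bool (X x = k) * g k)" for k
    by auto
  then have "expectation (\<lambda>x. of_bool (X x = k) * g (X x)) = prob {x \<in> space M. X x = k} * g k" for k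
    by (simp add: expectation_of_bool)
  moreover have "(\<lambda>k. expectation (\<lambda>x. of_bool (X x = k) * g (X x))) sums expectation (\<lambda>x. g (X x))"
    by (rule expectation_level_sums) (simp_all add: g)
  ultimately show ?thesis by simp
qed

section \<open>Paths of the branching process\<close>

text \<open>The two families may live on different sample spaces, which allows transferring the
  process to a product space of offspring numbers.\<close>

lemma gw_process_cong:
  "(\<And>u i. 1 \<le> u \<Longrightarrow> u \<le> t \<Longrightarrow> 1 \<le> i \<Longrightarrow> \<xi> u i x = \<zeta> u i y) \<Longrightarrow>
    gw_process \<xi> t x = gw_process \<zeta> t y"
  by (induction t) (auto intro!: sum.cong)

text \<open>The number of summands is random but takes countably many values, so it is enough to
  treat each fixed number.\<close>

lemma measurable_gw_process:
  assumes "\<And>u i. 1 \<le> u \<Longrightarrow> u \<le> t \<Longrightarrow> 1 \<le> i \<Longrightarrow> \<xi> u i \<in> measurable N (count_space UNIV)"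
  shows "gw_process \<xi> t \<in> measurable N (count_space UNIV)"
  using assms
proof (induction t)
  case (Suc t)
  note \<xi> = Suc.prems
  have "(\<lambda>x. \<Sum>i = 1..n. \<xi> (Suc t) i x) \<in> measurable N (count_space UNIV)" for n
  proof (induction n)
    case (Suc n)
    have "\<xi> (Suc t) (Suc n) \<in> measurable N (count_space UNIV)"
      by (rule \<xi>) simp_all
    then show ?case
      using Suc by simp
  qed simp
  moreover have "gw_process \<xi> t \<in> measurable N (count_space UNIV)"
    using Suc.prems by (intro Suc.IH) simp
  ultimately show ?case
    unfolding gw_process.simps by (rule measurable_compose_countable)
qed (simp add: gw_process.simps(1)[abs_def])

lemma gw_process_eq_0_mono: "gw_process \<xi> t x = 0 \<Longrightarrow> t \<le> u \<Longrightarrow> gw_process \<xi> u x = 0"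
  by (induction u) (auto simp: le_Suc_eq)

text \<open>If \<open>\<phi>\<^sub>t\<close> is the generating function of the offspring law of generation \<open>t\<close>, then
  \<open>1 / (1 - \<phi>\<^sub>t s)\<close> is an affine function of \<open>1 / (1 - s)\<close>. The coefficients below are those of the
  composition of the first \<open>t\<close> of these affine maps.\<close>

definition scale_coeff :: "(nat \<Rightarrow> real) \<Rightarrow> (nat \<Rightarrow> real) \<Rightarrow> nat \<Rightarrow> real" where
  "scale_coeff p \<alpha> t = (\<Prod>i<t. p (Suc i) / (1 - \<alpha> (Suc i)))"

definition shift_coeff :: "(nat \<Rightarrow> real) \<Rightarrow> (nat \<Rightarrow> real) \<Rightarrow> nat \<Rightarrow> real" where
  "shift_coeff p \<alpha> t = (\<Sum>i<t. scale_coeff p \<alpha> i * ((1 - p (Suc i)) / (1 - \<alpha> (Suc i))))"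

section \<open>The process in a fixed environment\<close>

locale quenched_gw = prob_space Q for Q :: "'b measure" +
  fixes p \<alpha> :: "nat \<Rightarrow> real" and \<xi> :: "nat \<Rightarrow> nat \<Rightarrow> 'b \<Rightarrow> nat"
  assumes p: "\<And>t. 1 \<le> t \<Longrightarrow> p t \<in> {0<..<1}"
    and \<alpha>: "\<And>t. 1 \<le> t \<Longrightarrow> \<alpha> t \<in> {0<..<1}"
    and offspring: "quenched_offspring p \<alpha> Q \<xi>"
begin

lemma indep: "indep_vars (\<lambda>_. count_space UNIV) (\<lambda>(t, i). \<xi> t i) ({1..} \<times> {1..})"
  using offspring unfolding quenched_offspring_def by blast

lemma measurable_offspring: "1 \<le> t \<Longrightarrow> 1 \<le> i \<Longrightarrow> \<xi> t i \<in> measurable Q (count_space UNIV)"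
  using indep unfolding indep_vars_def by auto

lemma measurable_N [measurable]: "gw_process \<xi> t \<in> measurable Q (count_space UNIV)"
  by (rule measurable_gw_process) (rule measurable_offspring)

definition pgf :: "nat \<Rightarrow> real \<Rightarrow> real" where
  "pgf t s = \<alpha> t + (1 - \<alpha> t) * p t * s / (1 - (1 - p t) * s)"

lemma expectation_power_offspring:
  assumes "1 \<le> t" "1 \<le> i" "0 \<le> s" "s < 1"
  shows "expectation (\<lambda>x. s ^ \<xi> t i x) = pgf t s"
proof -
  have "(\<lambda>k. prob {x \<in> space Q. \<xi> t i x = k} * s ^ k) sums expectation (\<lambda>x. s ^ \<xi> t i x)"
    using assms by (intro expectation_nat_sums measurable_offspring)
      (auto simp: power_le_one abs_if)
  moreover have "(\<lambda>k. prob {x \<in> space Q. \<xi> t i x = k} * s ^ k) =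
      (\<lambda>k. gen_geom (p t) (\<alpha> t) k * s ^ k)"
    using offspring assms unfolding quenched_offspring_def by auto
  moreover have "(\<lambda>k. gen_geom (p t) (\<alpha> t) k * s ^ k) sums pgf t s"
    unfolding pgf_def using p[of t] assms by (intro gen_geom_pgf_sums) auto
  ultimately show ?thesis
    using sums_unique2 by metis
qed

text \<open>The population at time \<open>t\<close> is built from generations up to
  \<open>t\<close>, the product from generation \<open>t + 1\<close>: disjoint index sets.\<close>

lemma indep_N_generation:
  fixes s :: real
  shows "indep_var borel (\<lambda>x. of_bool (gw_process \<xi> t x = k) :: real)
    borel (\<lambda>x. \<Prod>i = 1..k. s ^ \<xi> (Suc t) i x)"
proof -
  let ?A = "{1..t} \<times> {1::nat..}" and ?B = "{Suc t} \<times> {1::nat..}"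
  \<comment> \<open>The process is run on the coordinate functions of the product space, which
    exhibits it as a function of the restricted family.\<close>
  let ?f = "\<lambda>f. of_bool (gw_process (\<lambda>u i f. f (u, i)) t f = k) :: real"
    and ?g = "\<lambda>f. \<Prod>i = 1..k. s ^ (f (Suc t, i))"
  have "indep_var (PiM ?A (\<lambda>_. count_space UNIV)) (\<lambda>x. restrict (\<lambda>j. case_prod \<xi> j x) ?A)
      (PiM ?B (\<lambda>_. count_space UNIV)) (\<lambda>x. restrict (\<lambda>j. case_prod \<xi> j x) ?B)"
    by (rule indep_var_restrict[OF indep]) auto
  then have "indep_var borel (?f \<circ> (\<lambda>x. restrict (\<lambda>j. case_prod \<xi> j x) ?A))
      borel (?g \<circ> (\<lambda>x. restrict (\<lambda>j. case_prod \<xi> j x) ?B))"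
  proof (rule indep_var_compose)
    have "gw_process (\<lambda>u i f. f (u, i)) t \<in> measurable (PiM ?A (\<lambda>_. count_space UNIV)) (count_space UNIV)"
      by (rule measurable_gw_process) (auto intro!: measurable_component_singleton)
    then show "?f \<in> borel_measurable (PiM ?A (\<lambda>_. count_space UNIV))"
      by measurable
    have "(\<lambda>f. f (Suc t, i)) \<in> measurable (PiM ?B (\<lambda>_. count_space UNIV)) (count_space UNIV)"
      if "1 \<le> i" for i
      using that by (intro measurable_component_singleton) auto
    then have "(\<lambda>f. s ^ f (Suc t, i)) \<in> borel_measurable (PiM ?B (\<lambda>_. count_space UNIV))"
      if "1 \<le> i" for i
      using that measurable_compose[of _ _ "count_space UNIV" "\<lambda>n. s ^ n" borel] by auto
    then show "?g \<in> borel_measurable (PiM ?B (\<lambda>_. count_space UNIV))"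
      by (intro borel_measurable_prod) auto
  qed
  also have "?f \<circ> (\<lambda>x. restrict (\<lambda>j. case_prod \<xi> j x) ?A) =
      (\<lambda>x. of_bool (gw_process \<xi> t x = k))"
  proof
    fix x
    have "gw_process (\<lambda>u i f. f (u, i)) t (restrict (\<lambda>j. case_prod \<xi> j x) ?A) = gw_process \<xi> t x"
      by (rule gw_process_cong) auto
    then show "(?f \<circ> (\<lambda>x. restrict (\<lambda>j. case_prod \<xi> j x) ?A)) x = of_bool (gw_process \<xi> t x = k)"
      by simp
  qed
  also have "?g \<circ> (\<lambda>x. restrict (\<lambda>j. case_prod \<xi> j x) ?B) = (\<lambda>x. \<Prod>i = 1..k. s ^ \<xi> (Suc t) i x)"
    by (auto simp: fun_eq_iff intro!: prod.cong)
  finally show ?thesis .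
qed

lemma expectation_power_generation:
  assumes "0 \<le> s" "s < 1"
  shows "expectation (\<lambda>x. \<Prod>i = 1..k. s ^ \<xi> (Suc t) i x) = pgf (Suc t) s ^ k"
proof -
  have "indep_vars (\<lambda>_. count_space UNIV) (case_prod \<xi>) ((\<lambda>i. (Suc t, i)) ` {1..k})"
    by (rule indep_vars_subset[OF indep]) auto
  then have "indep_vars (\<lambda>_. borel) (\<lambda>j x. s ^ case_prod \<xi> j x) ((\<lambda>i. (Suc t, i)) ` {1..k})"
    by (rule indep_vars_compose2) simp
  then have "expectation (\<lambda>x. \<Prod>j\<in>(\<lambda>i. (Suc t, i)) ` {1..k}. s ^ case_prod \<xi> j x) =
      (\<Prod>j\<in>(\<lambda>i. (Suc t, i)) ` {1..k}. expectation (\<lambda>x. s ^ case_prod \<xi> j x))"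
  proof (rule indep_vars_lebesgue_integral[rotated])
    fix j assume j: "j \<in> (\<lambda>i. (Suc t, i)) ` {1..k}"
    then have "case_prod \<xi> j \<in> measurable Q (count_space UNIV)"
      by (auto intro: measurable_offspring)
    then show "integrable Q (\<lambda>x. s ^ case_prod \<xi> j x)"
      using assms by (intro integrable_const_bound[of _ 1]) (auto simp: power_le_one)
  qed simp
  then show ?thesis
    using assms by (simp add: prod.reindex inj_on_def expectation_power_offspring)
qed

lemma pgf_complement:
  assumes "1 \<le> t" "0 \<le> s" "s < 1"
  shows "1 - pgf t s = 1 / ((1 - p t) / (1 - \<alpha> t) + p t / (1 - \<alpha> t) / (1 - s))"
  unfolding pgf_def using p[of t] \<alpha>[of t] assms by (intro gen_geom_pgf_complement) auto

lemma pgf_less_1: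
  assumes "1 \<le> t" "0 \<le> s" "s < 1"
  shows "pgf t s < 1"
proof -
  have "0 < 1 - pgf t s"
    unfolding pgf_complement[OF assms] using p[of t] \<alpha>[of t] assms
    by (intro divide_pos_pos add_pos_pos) auto
  then show ?thesis by simp
qed

lemma pgf_nonneg:
  assumes "1 \<le> t" "0 \<le> s" "s < 1"
  shows "0 \<le> pgf t s"
  using expectation_power_offspring[OF assms(1) order.refl assms(2,3)] assms(2)
  by (metis Bochner_Integration.integral_nonneg zero_le_power)

lemma borel_measurable_of_N: "(\<lambda>x. g (gw_process \<xi> t x)) \<in> borel_measurable Q"
  by measurable

text \<open>The branching property: on the event that the population at time \<open>t\<close> is
  \<open>k\<close>, the power is a product of \<open>k\<close> offspring factors independent of that
  event. Both expectations are thus sums of the same series over \<open>k\<close>.\<close>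

lemma expectation_power_Suc:
  assumes s: "0 \<le> s" "s < 1"
  shows "expectation (\<lambda>x. s ^ gw_process \<xi> (Suc t) x) =
    expectation (\<lambda>x. pgf (Suc t) s ^ gw_process \<xi> t x)"
proof -
  let ?N = "gw_process \<xi> t" and ?r = "pgf (Suc t) s"
  have "expectation (\<lambda>x. of_bool (?N x = k) * s ^ gw_process \<xi> (Suc t) x) =
      prob {x \<in> space Q. ?N x = k} * ?r ^ k" for k
  proof -
    have "expectation (\<lambda>x. of_bool (?N x = k) * s ^ gw_process \<xi> (Suc t) x) =
        expectation (\<lambda>x. of_bool (?N x = k) * (\<Prod>i = 1..k. s ^ \<xi> (Suc t) i x))"
      by (rule arg_cong[where f = expectation]) (auto simp: fun_eq_iff power_sum)
    also have "\<dots> = expectation (\<lambda>x. of_bool (?N x = k)) *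
        expectation (\<lambda>x. \<Prod>i = 1..k. s ^ \<xi> (Suc t) i x)"
    proof (rule indep_var_lebesgue_integral[OF indep_N_generation])
      have "(\<lambda>x. of_bool (?N x = k) :: real) \<in> borel_measurable Q"
        by measurable
      then show "integrable Q (\<lambda>x. of_bool (?N x = k) :: real)"
        by (intro integrable_const_bound[of _ 1]) auto
      have "(\<lambda>x. \<Prod>i = 1..k. s ^ \<xi> (Suc t) i x) \<in> borel_measurable Q"
        using indep_var_rv2[OF indep_N_generation] .
      then show "integrable Q (\<lambda>x. \<Prod>i = 1..k. s ^ \<xi> (Suc t) i x)"
      proof (rule integrable_const_bound[of _ 1, rotated])
        have "\<bar>\<Prod>i = 1..k. s ^ \<xi> (Suc t) i x\<bar> \<le> 1" for x
          unfolding abs_prod using s by (intro prod_le_1) (simp add: power_le_one)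
        then show "AE x in Q. norm (\<Prod>i = 1..k. s ^ \<xi> (Suc t) i x) \<le> 1"
          by simp
      qed
    qed
    also have "\<dots> = prob {x \<in> space Q. ?N x = k} * ?r ^ k"
      using expectation_power_generation[OF s, of t k] by (subst expectation_of_bool) simp_all
    finally show ?thesis .
  qed
  moreover have "(\<lambda>k. expectation (\<lambda>x. of_bool (?N x = k) * s ^ gw_process \<xi> (Suc t) x)) sums
      expectation (\<lambda>x. s ^ gw_process \<xi> (Suc t) x)"
  proof (rule expectation_level_sums)
    show "\<bar>s ^ gw_process \<xi> (Suc t) x\<bar> \<le> 1" for x
      using s by (simp add: power_le_one del: gw_process.simps)
  qed (rule measurable_N borel_measurable_of_N)+
  moreover have "(\<lambda>k. prob {x \<in> space Q. ?N x = k} * ?r ^ k) sums expectation (\<lambda>x. ?r ^ ?N x)"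
    using pgf_nonneg[of "Suc t" s] pgf_less_1[of "Suc t" s] s
    by (intro expectation_nat_sums measurable_N) (simp add: power_le_one)
  ultimately show ?thesis
    by (simp only: sums_unique2)
qed

abbreviation "A \<equiv> shift_coeff p \<alpha>"
abbreviation "B \<equiv> scale_coeff p \<alpha>"

lemma scale_pos: "0 < B t"
  unfolding scale_coeff_def using p \<alpha> by (intro prod_pos divide_pos_pos) auto

lemma shift_nonneg: "0 \<le> A t"
  unfolding shift_coeff_def using p \<alpha> less_imp_le[OF scale_pos]
  by (intro sum_nonneg mult_nonneg_nonneg divide_nonneg_nonneg) (auto simp: less_imp_le)

text \<open>Induction removes the last generation, which replaces \<open>s\<close> by
  \<open>pgf (Suc t) s\<close>; hence \<open>s\<close> must be arbitrary.\<close>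

lemma expectation_power_N:
  assumes "0 \<le> s" "s < 1"
  shows "1 - expectation (\<lambda>x. s ^ gw_process \<xi> t x) = 1 / (A t + B t / (1 - s))"
  using assms
proof (induction t arbitrary: s)
  case 0
  then show ?case
    by (simp add: shift_coeff_def scale_coeff_def prob_space)
next
  case (Suc t)
  have "1 - expectation (\<lambda>x. s ^ gw_process \<xi> (Suc t) x) =
      1 - expectation (\<lambda>x. pgf (Suc t) s ^ gw_process \<xi> t x)"
    using expectation_power_Suc[OF Suc.prems] by simp
  also have "\<dots> = 1 / (A t + B t / (1 - pgf (Suc t) s))"
    using Suc.prems by (intro Suc.IH pgf_nonneg pgf_less_1) auto
  \<comment> \<open>The constant part of the affine map becomes the new summand of
    \<open>A (Suc t)\<close>, its slope the new factor of \<open>B (Suc t)\<close>.\<close>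
  also have "B t / (1 - pgf (Suc t) s) =
      B t * ((1 - p (Suc t)) / (1 - \<alpha> (Suc t))) + B (Suc t) / (1 - s)"
    using Suc.prems by (simp add: pgf_complement scale_coeff_def distrib_left)
  also have "A t + \<dots> = A (Suc t) + B (Suc t) / (1 - s)"
    by (simp add: shift_coeff_def)
  finally show ?case .
qed

lemma prob_N_pos: "prob {x \<in> space Q. 1 \<le> gw_process \<xi> t x} = 1 / (A t + B t)"
proof -
  \<comment> \<open>Since \<open>0 ^ 0 = 1\<close>, the case \<open>s = 0\<close> of the generating
    function is the extinction probability.\<close>
  have "(\<lambda>x. (0::real) ^ gw_process \<xi> t x) = (\<lambda>x. of_bool (gw_process \<xi> t x = 0))"
    by (auto simp: power_0_left)
  then have "prob {x \<in> space Q. gw_process \<xi> t x = 0} = 1 - 1 / (A t + B t)"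
    using expectation_power_N[of 0 t] expectation_of_bool[of "\<lambda>x. gw_process \<xi> t x = 0"] by simp
  moreover have "prob {x \<in> space Q. \<not> gw_process \<xi> t x = 0} =
      1 - prob {x \<in> space Q. gw_process \<xi> t x = 0}"
    by (rule prob_neg) measurable
  ultimately show ?thesis
    by (simp add: Suc_le_eq)
qed

text \<open>Subtracting \<open>0 ^ N\<close> from \<open>s ^ N\<close> discards extinction. The
  expected difference is a difference of two reciprocals with denominators at least 1, hence at most
  the difference of the denominators, from which \<open>A t\<close> cancels.\<close>

lemma prob_N_small:
  assumes "0 < y"
  shows "prob {x \<in> space Q. 1 \<le> gw_process \<xi> t x \<and> real (gw_process \<xi> t x) \<le> y} \<le> exp 1 * B t * y"
proof -
  let ?N = "gw_process \<xi> t"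
  define s where "s = exp (- 1 / y)"
  have s: "0 < s" "s < 1"
    using assms by (auto simp: s_def)
  \<comment> \<open>Markov's inequality for \<open>s ^ N\<close> on the event of survival: on \<open>1 \<le> N \<le> y\<close> it is at least \<open>1 / e\<close>.\<close>
  have pointwise: "of_bool (1 \<le> n \<and> real n \<le> y) \<le> exp 1 * (s ^ n - 0 ^ n)" for n
  proof (cases "1 \<le> n \<and> real n \<le> y")
    case True
    have "- 1 \<le> real n * (- 1 / y)"
      using True assms by (simp add: field_simps)
    then have "exp (- 1) \<le> s ^ n"
      by (simp add: s_def exp_of_nat_mult[symmetric])
    then have "exp 1 * exp (- 1) \<le> exp 1 * s ^ n"
      by (intro mult_left_mono) auto
    then show ?thesis
      using True by (simp add: exp_minus power_0_left)
  qed (use s in \<open>simp add: power_0_left\<close>)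
  have bounded_int: "integrable Q (\<lambda>x. c ^ ?N x)" if "0 \<le> c" "c \<le> 1" for c :: real
    using that by (intro integrable_const_bound[of _ 1]) (auto simp: power_le_one)
  have "prob {x \<in> space Q. 1 \<le> ?N x \<and> real (?N x) \<le> y} =
      expectation (\<lambda>x. of_bool (1 \<le> ?N x \<and> real (?N x) \<le> y))"
    by (rule expectation_of_bool[symmetric]) measurable
  also have "\<dots> \<le> expectation (\<lambda>x. exp 1 * (s ^ ?N x - 0 ^ ?N x))"
    using s by (intro integral_mono pointwise integrable_const_bound[of _ 1] integrable_mult_right
      Bochner_Integration.integrable_diff bounded_int) auto
  also have "\<dots> = exp 1 * (expectation (\<lambda>x. s ^ ?N x) - expectation (\<lambda>x. 0 ^ ?N x))"
    using s bounded_int[of s] bounded_int[of 0] by simp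
  also have "expectation (\<lambda>x. s ^ ?N x) - expectation (\<lambda>x. 0 ^ ?N x) =
      1 / (A t + B t) - 1 / (A t + B t / (1 - s))"
    using expectation_power_N[of s t] expectation_power_N[of 0 t] s by simp
  also have "\<dots> \<le> B t / (1 - s) - B t"
  proof -
    let ?a = "A t + B t" and ?b = "A t + B t / (1 - s)"
    have a: "?a > 0" and b: "?b > 0"
      using scale_pos[of t] shift_nonneg[of t] s by (auto intro!: add_nonneg_pos)
    \<comment> \<open>The left side is a survival probability.\<close>
    have "1 / ?a \<le> 1"
      unfolding prob_N_pos[symmetric] by simp
    then have a1: "1 \<le> ?a"
      using a by (simp add: field_simps)
    have "B t * (1 - s) \<le> B t"
      using s scale_pos[of t] by (intro mult_left_le) auto
    then have "B t \<le> B t / (1 - s)"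
      using s by (simp add: pos_le_divide_eq)
    then have ab: "?a \<le> ?b" by simp
    have "1 / ?a - 1 / ?b = (?b - ?a) / (?a * ?b)"
      using a b by (simp add: field_simps)
    also have "\<dots> \<le> (?b - ?a) / 1"
      using a1 ab mult_mono[of 1 ?a 1 ?b] by (intro divide_left_mono) auto
    finally show ?thesis by simp
  qed
  also have "B t / (1 - s) - B t \<le> B t * y"
  proof -
    \<comment> \<open>It remains to see that \<open>s / (1 - s) \<le> y\<close>, which is
      \<open>1 + 1 / y \<le> exp (1 / y)\<close> in disguise.\<close>
    have "s * exp (1 / y) = 1"
      by (simp add: s_def exp_minus)
    moreover have "1 + 1 / y \<le> exp (1 / y)"
      by (rule exp_ge_add_one_self)
    then have "s * (1 + 1 / y) \<le> s * exp (1 / y)"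
      using s by (intro mult_left_mono) auto
    ultimately have "s * (1 + 1 / y) \<le> 1"
      by simp
    then have "s * y + s \<le> y"
      using assms by (simp add: field_simps)
    then have "1 / (1 - s) - 1 \<le> y"
      using s by (simp add: field_simps)
    then have "B t * (1 / (1 - s) - 1) \<le> B t * y"
      using scale_pos[of t] by (intro mult_left_mono) auto
    then show ?thesis
      by (simp add: right_diff_distrib)
  qed
  finally show ?thesis
    by simp
qed

text \<open>Borel-Cantelli for the events that the population is alive but at most
  \<open>exp (c * t)\<close>.\<close>

lemma AE_exponential_growth:
  assumes "summable (\<lambda>t. B t * exp (c * real t))"
  shows "AE x in Q. (\<forall>t. 1 \<le> gw_process \<xi> t x) \<longrightarrow>
    (\<forall>\<^sub>F t in sequentially. exp (c * real t) \<le> real (gw_process \<xi> t x))"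
proof -
  let ?E = "\<lambda>t. {x \<in> space Q. 1 \<le> gw_process \<xi> t x \<and> real (gw_process \<xi> t x) \<le> exp (c * real t)}"
  have "AE x in Q. \<forall>\<^sub>F t in sequentially. x \<in> space Q - ?E t"
  proof (rule borel_cantelli_AE1)
    show "?E t \<in> sets Q" for t
      by measurable
    show "emeasure Q (?E t) < \<infinity>" for t
      by (simp add: emeasure_eq_measure)
    have "summable (\<lambda>t. exp 1 * (B t * exp (c * real t)))"
      by (rule summable_mult[OF assms])
    then show "summable (\<lambda>t. prob (?E t))"
    proof (rule summable_comparison_test')
      show "norm (prob (?E t)) \<le> exp 1 * (B t * exp (c * real t))" for t
        using prob_N_small[of "exp (c * real t)" t] by (simp add: mult.assoc)
    qed
  qed
  then show ?thesis
  proof eventually_elim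
    case (elim x)
    show ?case
    proof
      assume "\<forall>t. 1 \<le> gw_process \<xi> t x"
      with elim show "\<forall>\<^sub>F t in sequentially. exp (c * real t) \<le> real (gw_process \<xi> t x)"
        by (auto elim!: eventually_mono)
    qed
  qed
qed

text \<open>Extinction is absorbing, so the events decrease and continuity from above
  applies.\<close>

lemma prob_survival_ge:
  assumes "\<And>t. d \<le> prob {x \<in> space Q. 1 \<le> gw_process \<xi> t x}"
  shows "d \<le> prob {x \<in> space Q. \<forall>t. 1 \<le> gw_process \<xi> t x}"
proof -
  let ?E = "\<lambda>t. {x \<in> space Q. 1 \<le> gw_process \<xi> t x}"
  have "(\<lambda>t. prob (?E t)) \<longlonglongrightarrow> prob (\<Inter>t. ?E t)"
  proof (rule finite_Lim_measure_decseq)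
    show "range ?E \<subseteq> events"
      by auto
    show "decseq ?E"
    proof (rule decseq_SucI)
      show "?E (Suc t) \<subseteq> ?E t" for t
        using gw_process_eq_0_mono[of \<xi> t _ "Suc t"] by (force simp: Suc_le_eq simp del: gw_process.simps)
    qed
  qed
  then have "d \<le> prob (\<Inter>t. ?E t)"
    using assms by (intro LIMSEQ_le_const) auto
  also have "(\<Inter>t. ?E t) = {x \<in> space Q. \<forall>t. 1 \<le> gw_process \<xi> t x}"
    by auto
  finally show ?thesis .
qed

text \<open>The bound on \<open>B\<close> and the summability in \<open>shift\<close> keep
  \<open>A t + B t\<close> bounded, which controls survival; \<open>c < r\<close> makes
  \<open>B t * exp (c * t)\<close> decay geometrically, which controls growth.\<close>

lemma survival_and_growth:
  assumes scale: "\<And>t. B t \<le> exp (C - r * real t)" and c: "0 < c" "c < r"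
    and shift: "summable (\<lambda>i. B i * ((1 - p (Suc i)) / (1 - \<alpha> (Suc i))))"
  shows "\<exists>d>0. (\<forall>t. d \<le> prob {x \<in> space Q. 1 \<le> gw_process \<xi> t x}) \<and>
    d \<le> prob {x \<in> space Q. \<forall>\<^sub>F t in sequentially. exp (c * real t) \<le> real (gw_process \<xi> t x)} \<and>
    (AE x in Q. (\<forall>t. 1 \<le> gw_process \<xi> t x) \<longrightarrow>
      (\<forall>\<^sub>F t in sequentially. exp (c * real t) \<le> real (gw_process \<xi> t x)))"
proof -
  define S where "S = (\<Sum>i. B i * ((1 - p (Suc i)) / (1 - \<alpha> (Suc i))))"
  have nonneg: "0 \<le> B i * ((1 - p (Suc i)) / (1 - \<alpha> (Suc i)))" for i
    using scale_pos[of i] p[of "Suc i"] \<alpha>[of "Suc i"] by auto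
  have A: "A t \<le> S" for t
    unfolding shift_coeff_def S_def using nonneg by (intro sum_le_suminf shift) auto
  have B: "B t \<le> exp C" for t
    using c by (intro order.trans[OF scale]) simp
  \<comment> \<open>\<open>S\<close> bounds \<open>A t\<close> and \<open>exp C\<close> bounds
    \<open>B t\<close>, so \<open>d\<close> is below \<open>1 / (A t + B t)\<close> for all
    \<open>t\<close>.\<close>
  define d where "d = 1 / (S + exp C)"
  have S: "0 \<le> S"
    unfolding S_def using nonneg by (intro suminf_nonneg shift)
  then have d: "0 < d"
    unfolding d_def by (intro divide_pos_pos add_nonneg_pos) auto
  have prob: "d \<le> prob {x \<in> space Q. 1 \<le> gw_process \<xi> t x}" for t
    unfolding prob_N_pos d_def using A[of t] B[of t] shift_nonneg[of t] scale_pos[of t]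
    by (intro divide_left_mono mult_pos_pos) auto
  have "summable (\<lambda>t. B t * exp (c * real t))"
  proof (rule summable_comparison_test')
    show "summable (\<lambda>t. exp C * exp (c - r) ^ t)"
      using c by (intro summable_mult summable_geometric) simp
    show "norm (B t * exp (c * real t)) \<le> exp C * exp (c - r) ^ t" for t
    proof -
      have "norm (B t * exp (c * real t)) \<le> exp (C - r * real t) * exp (c * real t)"
        using scale[of t] scale_pos[of t] by (simp add: abs_mult)
      also have "\<dots> = exp C * exp (c - r) ^ t"
        by (simp add: exp_add[symmetric] exp_of_nat_mult[symmetric] algebra_simps)
      finally show ?thesis .
    qed
  qed
  then have growth: "AE x in Q. (\<forall>t. 1 \<le> gw_process \<xi> t x) \<longrightarrow>
      (\<forall>\<^sub>F t in sequentially. exp (c * real t) \<le> real (gw_process \<xi> t x))"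
    by (rule AE_exponential_growth)
  have "d \<le> prob {x \<in> space Q. \<forall>t. 1 \<le> gw_process \<xi> t x}"
    by (rule prob_survival_ge) (rule prob)
  \<comment> \<open>Survival is contained in growth only up to a null set.\<close>
  also have "\<dots> \<le> prob {x \<in> space Q. \<forall>\<^sub>F t in sequentially. exp (c * real t) \<le> real (gw_process \<xi> t x)}"
  proof (rule finite_measure_mono_AE)
    show "AE x in Q. x \<in> {x \<in> space Q. \<forall>t. 1 \<le> gw_process \<xi> t x} \<longrightarrow>
        x \<in> {x \<in> space Q. \<forall>\<^sub>F t in sequentially. exp (c * real t) \<le> real (gw_process \<xi> t x)}"
      using growth by eventually_elim simp
  qed measurable
  finally show ?thesis
    using d prob growth by blast
qed

end

section \<open>Almost sure behaviour of the environment\<close>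

text \<open>Step \<open>i\<close> belongs to generation \<open>i + 1\<close>, because environments
  are indexed from 1 and walks from 0. The steps have mean \<open>r - \<gamma>\<close>.\<close>

lemma iid_sequence_of_environment:
  assumes env: "iid_environment M p \<alpha>"
    and int: "integrable M (\<lambda>\<omega>. ln ((1 - \<alpha> 1 \<omega>) / p 1 \<omega>))"
  shows "iid_sequence M (\<lambda>i \<omega>. r - ln ((1 - \<alpha> (Suc i) \<omega>) / p (Suc i) \<omega>))"
proof -
  interpret prob_space M
    using env unfolding iid_environment_def by blast
  let ?Z = "\<lambda>t \<omega>. (p t \<omega>, \<alpha> t \<omega>)" and ?g = "\<lambda>z::real \<times> real. r - ln ((1 - snd z) / fst z)"
  have g: "?g \<in> borel_measurable borel"
    unfolding borel_prod[symmetric] by measurable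
  have indep: "indep_vars (\<lambda>_. borel) ?Z {1..}"
    and distr: "\<And>t. 1 \<le> t \<Longrightarrow> distr M borel (?Z t) = distr M borel (?Z 1)"
    using env unfolding iid_environment_def by blast+
  have Z: "?Z t \<in> borel_measurable M" if "1 \<le> t" for t
    using indep that unfolding indep_vars_def by auto
  show ?thesis
  proof unfold_locales
    \<comment> \<open>The singleton blocks \<open>{Suc i}\<close> renumber the independent family
      from 0.\<close>
    have "indep_vars (\<lambda>i. PiM {Suc i} (\<lambda>_. borel)) (\<lambda>i \<omega>. restrict (\<lambda>t. ?Z t \<omega>) {Suc i}) UNIV"
      by (rule indep_vars_restrict[OF indep]) (auto simp: disjoint_family_on_def)
    then have "indep_vars (\<lambda>_. borel) (\<lambda>i \<omega>. ?g (restrict (\<lambda>t. ?Z t \<omega>) {Suc i} (Suc i))) UNIV"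
      by (rule indep_vars_compose2)
        (intro measurable_compose[OF _ g] measurable_component_singleton, simp)
    then show "indep_vars (\<lambda>_. borel) (\<lambda>i \<omega>. r - ln ((1 - \<alpha> (Suc i) \<omega>) / p (Suc i) \<omega>)) UNIV"
      by simp
    have "distr M borel (\<lambda>\<omega>. ?g (?Z (Suc i) \<omega>)) = distr (distr M borel (?Z 1)) borel ?g" for i
      using distr[of "Suc i"] distr_distr[OF g Z[of "Suc i"]] by (simp add: comp_def)
    then show "distr M borel (\<lambda>\<omega>. r - ln ((1 - \<alpha> (Suc i) \<omega>) / p (Suc i) \<omega>)) =
        distr M borel (\<lambda>\<omega>. r - ln ((1 - \<alpha> (Suc 0) \<omega>) / p (Suc 0) \<omega>))" for i
      by simp
    show "integrable M (\<lambda>\<omega>. r - ln ((1 - \<alpha> (Suc 0) \<omega>) / p (Suc 0) \<omega>))"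
      using int by simp
  qed
qed

text \<open>The logarithm of the scale coefficient plus \<open>r * t\<close> is a walk with negative
  mean, hence bounded above; the bound is \<open>C\<close>.\<close>

lemma AE_scale_coeff_bound:
  assumes env: "iid_environment M p \<alpha>"
    and int: "integrable M (\<lambda>\<omega>. ln ((1 - \<alpha> 1 \<omega>) / p 1 \<omega>))"
    and r: "r < (\<integral>\<omega>. ln ((1 - \<alpha> 1 \<omega>) / p 1 \<omega>) \<partial>M)"
  shows "AE \<omega> in M. \<exists>C. \<forall>t. scale_coeff (\<lambda>t. p t \<omega>) (\<lambda>t. \<alpha> t \<omega>) t \<le> exp (C - r * real t)"
proof -
  interpret iid_sequence M "\<lambda>i \<omega>. r - ln ((1 - \<alpha> (Suc i) \<omega>) / p (Suc i) \<omega>)"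
    by (rule iid_sequence_of_environment[OF env int])
  have "expectation (\<lambda>\<omega>. r - ln ((1 - \<alpha> (Suc 0) \<omega>) / p (Suc 0) \<omega>)) < 0"
    using int r by (simp add: prob_space)
  from AE_partial_sums_bounded[OF this] AE_space show ?thesis
  proof eventually_elim
    case (elim \<omega>)
    then obtain C where C: "(\<Sum>i<n. r - ln ((1 - \<alpha> (Suc i) \<omega>) / p (Suc i) \<omega>)) \<le> C" for n
      by blast
    have "scale_coeff (\<lambda>t. p t \<omega>) (\<lambda>t. \<alpha> t \<omega>) t =
        exp ((\<Sum>i<t. r - ln ((1 - \<alpha> (Suc i) \<omega>) / p (Suc i) \<omega>)) - r * real t)" for t
    proof -
      have "p (Suc i) \<omega> / (1 - \<alpha> (Suc i) \<omega>) = exp (- ln ((1 - \<alpha> (Suc i) \<omega>) / p (Suc i) \<omega>))" for i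
      proof -
        have "p (Suc i) \<omega> \<in> {0<..<1}" "\<alpha> (Suc i) \<omega> \<in> {0<..<1}"
          using env elim(2) unfolding iid_environment_def by auto
        then show ?thesis
          by (simp add: exp_minus)
      qed
      then show ?thesis
        by (simp add: scale_coeff_def exp_sum[symmetric] sum_subtractf sum_negf mult.commute)
    qed
    then show ?case
      using C by auto
  qed
qed

lemma AE_retention_lower_bound:
  assumes env: "iid_environment M p \<alpha>"
    and sum: "(\<lambda>t. measure M {\<omega> \<in> space M. 1 - \<alpha> t \<omega> < exp (- a * real t)}) summable_on {1..}"
  shows "AE \<omega> in M. \<forall>\<^sub>F i in sequentially. exp (- a * real (Suc i)) \<le> 1 - \<alpha> (Suc i) \<omega>"
proof -
  interpret prob_space M
    using env unfolding iid_environment_def by blast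
  let ?E = "\<lambda>t. {\<omega> \<in> space M. 1 - \<alpha> t \<omega> < exp (- a * real t)}"
  have snd: "snd \<in> borel_measurable (borel :: (real \<times> real) measure)"
    unfolding borel_prod[symmetric] by measurable
  have "(\<lambda>\<omega>. (p t \<omega>, \<alpha> t \<omega>)) \<in> borel_measurable M" if "1 \<le> t" for t
    using env that unfolding iid_environment_def indep_vars_def by auto
  from measurable_compose[OF this snd]
  have [measurable]: "\<alpha> (Suc i) \<in> borel_measurable M" for i
    by simp
  have "AE \<omega> in M. \<forall>\<^sub>F i in sequentially. \<omega> \<in> space M - ?E (Suc i)"
  proof (rule borel_cantelli_AE1)
    show "?E (Suc i) \<in> sets M" for i
      by measurable
    show "emeasure M (?E (Suc i)) < \<infinity>" for i
      by (simp add: emeasure_eq_measure)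
    \<comment> \<open>Turns the unordered sum over \<open>t \<ge> 1\<close> into one over all
      naturals, to be read as a series.\<close>
    have "(\<lambda>i. measure M (?E (Suc i))) summable_on UNIV"
    proof -
      have "bij_betw Suc UNIV {1..}"
        by (rule bij_betwI[where g = "\<lambda>n. n - 1"]) auto
      from summable_on_reindex_bij_betw[OF this, of "\<lambda>t. measure M (?E t)"] sum show ?thesis
        by simp
    qed
    then show "summable (\<lambda>i. measure M (?E (Suc i)))"
      by (subst (asm) summable_on_UNIV_nonneg_real_iff) simp_all
  qed
  then show ?thesis
    by eventually_elim (auto elim!: eventually_mono)
qed

section \<open>Survival and growth in almost every environment\<close>

theorem theorem3p1:
  fixes M :: "'a measure" and p \<alpha> :: "nat \<Rightarrow> 'a \<Rightarrow> real"
    and Q :: "'a \<Rightarrow> 'b measure" and \<xi> :: "nat \<Rightarrow> nat \<Rightarrow> 'b \<Rightarrow> nat"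
    and \<gamma> \<delta> :: real
  assumes "iid_environment M p \<alpha>"
    and "AE \<omega> in M. quenched_offspring (\<lambda>t. p t \<omega>) (\<lambda>t. \<alpha> t \<omega>) (Q \<omega>) \<xi>"
    and "integrable M (\<lambda>\<omega>. ln ((1 - \<alpha> 1 \<omega>) / p 1 \<omega>))"
    and "\<gamma> = (\<integral>\<omega>. ln ((1 - \<alpha> 1 \<omega>) / p 1 \<omega>) \<partial>M)"
    and "\<gamma> > 0"
    and "\<delta> > 0"
    and "(\<lambda>t. measure M {\<omega> \<in> space M. 1 - \<alpha> t \<omega> < exp (- (\<gamma> - \<delta>) * real t)}) summable_on {1..}"
  shows "\<exists>c>0. AE \<omega> in M. \<exists>\<delta>\<^sub>1>0.
           (\<forall>t. measure (Q \<omega>) {x \<in> space (Q \<omega>). gw_process \<xi> t x \<ge> 1} \<ge> \<delta>\<^sub>1) \<and>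
           measure (Q \<omega>) {x \<in> space (Q \<omega>).
             \<forall>\<^sub>F t in sequentially. real (gw_process \<xi> t x) \<ge> exp (c * real t)} \<ge> \<delta>\<^sub>1 \<and>
           (AE x in Q \<omega>. (\<forall>t. gw_process \<xi> t x \<ge> 1) \<longrightarrow>
             (\<forall>\<^sub>F t in sequentially. real (gw_process \<xi> t x) \<ge> exp (c * real t)))"
proof -
  \<comment> \<open>A rate strictly between the larger of \<open>0\<close> and
    \<open>\<gamma> - \<delta>\<close> and \<open>\<gamma>\<close>; the minimum keeps it positive
    also when \<open>\<delta>\<close> exceeds \<open>\<gamma>\<close>.\<close>
  define r where "r = \<gamma> - min \<gamma> \<delta> / 2"
  have r: "0 < r" "r < \<gamma>" "\<gamma> - \<delta> < r"
    using assms(5,6) by (auto simp: r_def min_def)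
  have scale: "AE \<omega> in M. \<exists>C. \<forall>t. scale_coeff (\<lambda>t. p t \<omega>) (\<lambda>t. \<alpha> t \<omega>) t \<le> exp (C - r * real t)"
    using r(2) assms(4) by (intro AE_scale_coeff_bound[OF assms(1,3)]) simp
  show ?thesis
  proof (intro exI conjI)
    \<comment> \<open>The growth rate is fixed before the environment, so it is the same for all
      \<open>\<omega>\<close>; any number between 0 and \<open>r\<close> would do.\<close>
    show "0 < r / 2" using r by simp
    show "AE \<omega> in M. \<exists>\<delta>\<^sub>1>0.
           (\<forall>t. measure (Q \<omega>) {x \<in> space (Q \<omega>). gw_process \<xi> t x \<ge> 1} \<ge> \<delta>\<^sub>1) \<and>
           measure (Q \<omega>) {x \<in> space (Q \<omega>).
             \<forall>\<^sub>F t in sequentially. real (gw_process \<xi> t x) \<ge> exp (r / 2 * real t)} \<ge> \<delta>\<^sub>1 \<and>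
           (AE x in Q \<omega>. (\<forall>t. gw_process \<xi> t x \<ge> 1) \<longrightarrow>
             (\<forall>\<^sub>F t in sequentially. real (gw_process \<xi> t x) \<ge> exp (r / 2 * real t)))"
      using scale AE_retention_lower_bound[OF assms(1,7)] assms(2) AE_space
    proof eventually_elim
      case (elim \<omega>)
      let ?p = "\<lambda>t. p t \<omega>" and ?\<alpha> = "\<lambda>t. \<alpha> t \<omega>"
      interpret quenched_gw "Q \<omega>" ?p ?\<alpha> \<xi>
        using elim(3,4) assms(1)
        unfolding quenched_gw_def quenched_gw_axioms_def quenched_offspring_def iid_environment_def
        by blast
      obtain C where C: "B t \<le> exp (C - r * real t)" for t
        using elim(1) by blast
      have "summable (\<lambda>i. B i * ((1 - ?p (Suc i)) / (1 - ?\<alpha> (Suc i))))"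
      proof (rule summable_comparison_test_ev)
        \<comment> \<open>The extra factor \<open>exp (\<gamma> - \<delta>)\<close> comes from
          pairing the scale coefficient at \<open>i\<close> with the retention probability at
          \<open>i + 1\<close>.\<close>
        show "summable (\<lambda>i. exp (C + \<gamma> - \<delta>) * exp (\<gamma> - \<delta> - r) ^ i)"
          using r by (intro summable_mult summable_geometric) simp
        show "\<forall>\<^sub>F i in sequentially. norm (B i * ((1 - ?p (Suc i)) / (1 - ?\<alpha> (Suc i)))) \<le>
            exp (C + \<gamma> - \<delta>) * exp (\<gamma> - \<delta> - r) ^ i"
          using elim(2)
        proof eventually_elim
          case (elim i)
          have p1: "0 \<le> 1 - ?p (Suc i)" "1 - ?p (Suc i) \<le> 1" and \<alpha>1: "0 < 1 - ?\<alpha> (Suc i)"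
            using p[of "Suc i"] \<alpha>[of "Suc i"] by auto
          have "(1 - ?p (Suc i)) / (1 - ?\<alpha> (Suc i)) \<le> 1 / exp (- (\<gamma> - \<delta>) * real (Suc i))"
            using elim p1 \<alpha>1 by (intro frac_le) auto
          also have "\<dots> = exp ((\<gamma> - \<delta>) * real (Suc i))"
            by (simp add: exp_minus[symmetric] inverse_eq_divide[symmetric] algebra_simps)
          finally have "B i * ((1 - ?p (Suc i)) / (1 - ?\<alpha> (Suc i))) \<le>
              exp (C - r * real i) * exp ((\<gamma> - \<delta>) * real (Suc i))"
            using C[of i] scale_pos[of i] p1 \<alpha>1 by (intro mult_mono) auto
          also have "\<dots> = exp (C + \<gamma> - \<delta>) * exp (\<gamma> - \<delta> - r) ^ i"
            by (simp add: exp_add[symmetric] exp_of_nat_mult[symmetric] algebra_simps)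
          finally show ?case
            using scale_pos[of i] p1 \<alpha>1 by (simp add: abs_mult)
        qed
      qed
      then show ?case
        using r by (intro survival_and_growth[OF C]) auto
    qed
  qed
qed

end
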